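(* Let $D$ be a finite digraph without loops and without parallel arcs in the same direction. If every directed cycle $B$ of length at least $3$ in $D$ has at least $\frac{2}{3}\|B\| + 1$ symmetric arcs, then $D$ has a $4$-kernel.
   Context: A digraph $D=(V(D),A(D))$ may contain both $(u,v)$ and $(v,u)$ as arcs. An arc $(u,v)$ of $D$ is symmetric if $(v,u)$ is also an arc of $D$; the number of symmetric arcs of a directed cycle $B$ is the number of arcs of $B$ that are symmetric in $D$. $\|B\|$ denotes the length (number of arcs) of $B$. $d_D(u,v)$ is the length of a shortest directed path from $u$ to $v$ ($\infty$ if none exists). A set $S \subseteq V(D)$ is $k$-independent if $d_D(u,v)\ge k$ for every two distinct $u,v\in S$ (in both directions), and $\ell$-absorbent if for every $u \in V(D)\setminus S$ there is $v\in S$ with $d_D(u,v)\le \ell$. A $k$-kernel is a $k$-independent and $(k-1)$-absorbent set; thus a $4$-kernel is a $4$-independent and $3$-absorbent set. *)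

theory Defs
  imports "Graph_Theory.Shortest_Path"
begin

(* The cost of a walk under the constant weight 1 is its length, so the shortest-path
   weight is the distance; it is infinite if there is no walk.
   Walks may be replaced by paths, see digraph_dist_le_iff. *)
definition digraph_dist :: "('a, 'b) pre_digraph \<Rightarrow> 'a \<Rightarrow> 'a \<Rightarrow> ereal" where
  "digraph_dist G u v = wf_digraph.\<mu> G (\<lambda>_. 1) u v"

definition k_independent :: "('a, 'b) pre_digraph \<Rightarrow> nat \<Rightarrow> 'a set \<Rightarrow> bool" where
  "k_independent G k S \<longleftrightarrow> S \<subseteq> verts G \<and>
     (\<forall>u\<in>S. \<forall>v\<in>S. u \<noteq> v \<longrightarrow> ereal (real k) \<le> digraph_dist G u v)"

definition l_absorbent :: "('a, 'b) pre_digraph \<Rightarrow> nat \<Rightarrow> 'a set \<Rightarrow> bool" where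
  "l_absorbent G l S \<longleftrightarrow> S \<subseteq> verts G \<and>
     (\<forall>u \<in> verts G - S. \<exists>v\<in>S. digraph_dist G u v \<le> ereal (real l))"

(* The subtraction on natural numbers is only meaningful for k > 0. *)
definition k_kernel :: "('a, 'b) pre_digraph \<Rightarrow> nat \<Rightarrow> 'a set \<Rightarrow> bool" where
  "k_kernel G k S \<longleftrightarrow> k_independent G k S \<and> l_absorbent G (k - 1) S"

definition symmetric_arc :: "('a, 'b) pre_digraph \<Rightarrow> 'b \<Rightarrow> bool" where
  "symmetric_arc G e \<longleftrightarrow> e \<in> arcs G \<and> (head G e, tail G e) \<in> arcs_ends G"

(* The arcs of a cycle are pairwise distinct, so counting the set is counting the list. *)
definition num_symmetric_arcs :: "('a, 'b) pre_digraph \<Rightarrow> 'b awalk \<Rightarrow> nat" where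
  "num_symmetric_arcs G B = card {e \<in> set B. symmetric_arc G e}"

lemma (in wf_digraph) awalk_cost_1: "awalk_cost (\<lambda>_. 1) p = real (length p)"
  by (induction p) auto

lemma (in fin_digraph) digraph_dist_le_iff:
  "digraph_dist G u v \<le> ereal (real k) \<longleftrightarrow> (\<exists>p. apath u p v \<and> length p \<le> k)"
proof
  assume le: "digraph_dist G u v \<le> ereal (real k)"
  then have "u \<rightarrow>\<^sup>* v"
    using shortest_path_inf[of u v "\<lambda>_. 1"] by (cases "u \<rightarrow>\<^sup>* v") (auto simp: digraph_dist_def)
  then obtain p where p: "apath u p v" "\<mu> (\<lambda>_. 1) u v = awalk_cost (\<lambda>_. 1) p"
    using min_cost_awalk[of u v "\<lambda>_. 1"] by auto
  then have "length p \<le> k"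
    using le by (simp add: digraph_dist_def awalk_cost_1)
  with p show "\<exists>p. apath u p v \<and> length p \<le> k" by blast
next
  assume "\<exists>p. apath u p v \<and> length p \<le> k"
  then obtain p where p: "apath u p v" "length p \<le> k" by blast
  have "\<mu> (\<lambda>_. 1) u v \<le> ereal (real (length p))"
    using min_cost_le_walk_cost[OF awalkI_apath[OF p(1)], of "\<lambda>_. 1"] by (simp add: awalk_cost_1)
  also have "\<dots> \<le> ereal (real k)" using p(2) by simp
  finally show "digraph_dist G u v \<le> ereal (real k)" by (simp add: digraph_dist_def)
qed

end

theory Submission
  imports Defs
begin

text \<open>
  Write \<open>n\<close> for \<open>k - 1\<close>, where \<open>k = 4\<close> is the case of interest, and say that \<open>u\<close> reaches \<open>v\<close> if
  the distance from \<open>u\<close> to \<open>v\<close> is at most \<open>n\<close>. A \<open>k\<close>-kernel is the same as a kernel of the reaching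
  relation, that is, an independent set such that every other vertex reaches one of its members.
  Duchet's theorem provides a kernel of a finite relation as soon as its asymmetric part is acyclic
  (\<open>acyclic_asymmetric_part_imp_kernel\<close>), so only this acyclicity has to be shown.

  Suppose that \<open>u\<close> reaches \<open>v\<close> but not conversely. A shortest path from \<open>u\<close> to \<open>v\<close> has at most \<open>n\<close>
  arcs, and one of them is asymmetric, for otherwise the path could be traversed backwards. Hence
  at least the fraction \<open>1/n\<close> of its arcs is asymmetric. A cycle of the asymmetric part of the
  reaching relation thus expands to a nonempty closed walk with the same property
  (\<open>trancl_one_way_reach_imp_awalk\<close>). But a closed walk splits into cycles. Those of length at most 2
  consist of symmetric arcs, and by hypothesis fewer than a third of the arcs of any longer one are
  asymmetric, so the closed walk has fewer than the fraction \<open>1/n\<close> of asymmetric arcs for \<open>n = 3\<close>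
  (\<open>closed_awalk_asymmetric_arcs_less\<close>), a contradiction.
\<close>

text \<open>
  Some vertex \<open>v\<close> has no successor in the asymmetric part. Delete \<open>v\<close> together with everything that is
  related to \<open>v\<close>, and add \<open>v\<close> to a kernel of the rest: no remaining vertex is related to \<open>v\<close>, and hence,
  by the choice of \<open>v\<close>, neither is \<open>v\<close> related to a remaining vertex.
\<close>

lemma acyclic_asymmetric_part_imp_kernel:
  fixes R :: "'a \<Rightarrow> 'a \<Rightarrow> bool"
  assumes "finite V"
    and acyc: "acyclic {(u, v). u \<in> V \<and> v \<in> V \<and> R u v \<and> \<not> R v u}"
  shows "\<exists>S\<subseteq>V. (\<forall>u\<in>S. \<forall>v\<in>S. u \<noteq> v \<longrightarrow> \<not> R u v) \<and> (\<forall>u\<in>V - S. \<exists>v\<in>S. R u v)"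
  using assms
proof (induction V rule: finite_psubset_induct)
  case (psubset V)
  show ?case
  proof (cases "V = {}")
    case True
    then show ?thesis by auto
  next
    case False
    define P where "P = {(u, v). u \<in> V \<and> v \<in> V \<and> R u v \<and> \<not> R v u}"
    have "finite P"
      by (rule finite_subset[of _ "V \<times> V"]) (use psubset.hyps in \<open>auto simp: P_def\<close>)
    then have "wf (P\<inverse>)"
      using psubset.prems by (intro finite_acyclic_wf_converse) (auto simp: P_def)
    then obtain v where v: "v \<in> V" and vmax: "\<And>w. (v, w) \<in> P \<Longrightarrow> w \<notin> V"
      using False by (metis wfE_min' converse_iff)
    have v_sym: "R w v" if "w \<in> V" "R v w" for w
      using that v vmax[of w] by (auto simp: P_def)
    define W where "W = V - {v} - {u. R u v}"
    have "W \<subset> V" using v by (auto simp: W_def)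
    have "acyclic {(u, w). u \<in> W \<and> w \<in> W \<and> R u w \<and> \<not> R w u}"
      by (rule acyclic_subset[OF psubset.prems]) (auto simp: W_def)
    then obtain S where S: "S \<subseteq> W" "\<forall>u\<in>S. \<forall>w\<in>S. u \<noteq> w \<longrightarrow> \<not> R u w"
      "\<forall>u\<in>W - S. \<exists>w\<in>S. R u w"
      using psubset.IH[OF \<open>W \<subset> V\<close>] by auto
    have "\<forall>s\<in>S. \<not> R s v \<and> \<not> R v s"
      using S(1) v_sym by (auto simp: W_def)
    then have "\<forall>u\<in>insert v S. \<forall>w\<in>insert v S. u \<noteq> w \<longrightarrow> \<not> R u w"
      using S(2) by auto
    moreover have "\<forall>u\<in>V - insert v S. \<exists>w\<in>insert v S. R u w"
      using S(3) by (auto simp: W_def)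
    moreover have "insert v S \<subseteq> V"
      using S(1) v by (auto simp: W_def)
    ultimately show ?thesis by blast
  qed
qed

definition num_asymmetric_arcs :: "('a, 'b) pre_digraph \<Rightarrow> 'b awalk \<Rightarrow> nat" where
  "num_asymmetric_arcs G p = length (filter (\<lambda>e. \<not> symmetric_arc G e) p)"

lemma num_asymmetric_arcs_append [simp]:
  "num_asymmetric_arcs G (p @ q) = num_asymmetric_arcs G p + num_asymmetric_arcs G q"
  by (simp add: num_asymmetric_arcs_def)

lemma (in wf_digraph) reverse_awalk_of_symmetric_arcs:
  assumes "awalk u p v" "\<forall>e\<in>set p. symmetric_arc G e"
  shows "\<exists>q. awalk v q u \<and> length q = length p"
  using assms
proof (induction p arbitrary: u)
  case Nil
  then show ?case by (metis awalk_Nil_iff)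
next
  case (Cons e p)
  then obtain q where q: "awalk v q (head G e)" "length q = length p"
    by (auto simp: awalk_Cons_iff)
  obtain f where "f \<in> arcs G" "tail G f = head G e" "head G f = u"
    using Cons.prems by (auto simp: symmetric_arc_def awalk_Cons_iff arcs_ends_def arc_to_ends_def)
  then have "awalk (head G e) [f] u"
    by (auto simp: awalk_Cons_iff awalk_Nil_iff)
  with q have "awalk v (q @ [f]) u" by (blast intro: awalk_appendI)
  with q(2) show ?case by (intro exI[of _ "q @ [f]"]) simp
qed

lemma (in fin_digraph) awalk_imp_digraph_dist_le:
  assumes "awalk u p v" "length p \<le> n"
  shows "digraph_dist G u v \<le> ereal (real n)"
proof -
  have "digraph_dist G u v \<le> ereal (real (length p))"
    using min_cost_le_walk_cost[OF assms(1), of "\<lambda>_. 1"]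
    by (simp add: awalk_cost_1 digraph_dist_def)
  also have "\<dots> \<le> ereal (real n)" using assms(2) by simp
  finally show ?thesis .
qed

lemma (in fin_digraph) digraph_dist_ge_Suc:
  assumes "\<not> digraph_dist G u v \<le> ereal (real n)"
  shows "ereal (real (Suc n)) \<le> digraph_dist G u v"
proof (cases "u \<rightarrow>\<^sup>* v")
  case True
  then obtain p where "apath u p v" "digraph_dist G u v = ereal (real (length p))"
    using min_cost_awalk[of u v "\<lambda>_. 1"] by (auto simp: awalk_cost_1 digraph_dist_def)
  with assms show ?thesis by simp
next
  case False
  then show ?thesis
    using shortest_path_inf[of u v "\<lambda>_. 1"] by (simp add: digraph_dist_def)
qed

lemma (in fin_digraph) one_way_reach_imp_awalk:
  assumes "digraph_dist G u v \<le> ereal (real n)" "\<not> digraph_dist G v u \<le> ereal (real n)"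
  shows "\<exists>p. awalk u p v \<and> p \<noteq> [] \<and> length p \<le> n * num_asymmetric_arcs G p"
proof -
  obtain p where p: "awalk u p v" "length p \<le> n"
    using assms(1) by (auto simp: digraph_dist_le_iff apath_def)
  have asym: "\<exists>e\<in>set p. \<not> symmetric_arc G e"
    using reverse_awalk_of_symmetric_arcs[OF p(1)] awalk_imp_digraph_dist_le[of v _ u n] assms(2) p(2)
    by metis
  then have "p \<noteq> []" by auto
  moreover have "1 \<le> num_asymmetric_arcs G p"
    using asym by (simp add: num_asymmetric_arcs_def Suc_le_eq filter_empty_conv)
  then have "length p \<le> n * num_asymmetric_arcs G p"
    using p(2) by (metis le_trans mult_le_mono2 mult.right_neutral)
  ultimately show ?thesis using p(1) by blast
qed

lemma (in fin_digraph) trancl_one_way_reach_imp_awalk: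
  assumes "(u, v) \<in> {(u, v). u \<in> verts G \<and> v \<in> verts G \<and>
      digraph_dist G u v \<le> ereal (real n) \<and> \<not> digraph_dist G v u \<le> ereal (real n)}\<^sup>+"
  shows "\<exists>p. awalk u p v \<and> p \<noteq> [] \<and> length p \<le> n * num_asymmetric_arcs G p"
  using assms
proof (induction rule: trancl_induct)
  case (base v)
  then show ?case using one_way_reach_imp_awalk by blast
next
  case (step v w)
  then obtain p where p: "awalk u p v" "p \<noteq> []" "length p \<le> n * num_asymmetric_arcs G p"
    by blast
  obtain q where q: "awalk v q w" "length q \<le> n * num_asymmetric_arcs G q"
    using step.hyps one_way_reach_imp_awalk[of v w n] by blast
  have "awalk u (p @ q) w" using p q by (blast intro: awalk_appendI)
  then show ?case
    using p q by (intro exI[of _ "p @ q"]) (simp add: algebra_simps)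
qed

text \<open>
  The bound is additive over concatenation, so it passes from cycles to closed walks: a closed walk
  that is not a cycle contains a proper closed subwalk, and what remains after cutting out this
  subwalk is again a nonempty closed walk.
\<close>

lemma (in wf_digraph) closed_awalk_asymmetric_arcs_less:
  assumes cyc: "\<And>B. cycle B \<Longrightarrow> length B \<ge> 3 \<Longrightarrow> n * num_asymmetric_arcs G B < length B"
    and "awalk u p u" "p \<noteq> []"
  shows "n * num_asymmetric_arcs G p < length p"
  using assms(2,3)
proof (induction "length p" arbitrary: u p rule: less_induct)
  case less
  then obtain e es where p: "p = e # es" by (cases p) auto
  show ?case
  proof (cases "distinct (tl (awalk_verts u p))")
    case True
    then have "cycle p" using less.prems by (auto simp: cycle_def)
    show ?thesis
    proof (cases "length p \<ge> 3")
      case True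
      then show ?thesis using cyc \<open>cycle p\<close> by blast
    next
      case False
      (* A loop is its own reverse, and the two arcs of a 2-cycle reverse each other. *)
      then have "p = [e] \<or> (\<exists>f. p = [e, f])"
        using p by (cases es; cases "tl es") auto
      then have "\<forall>e\<in>set p. symmetric_arc G e"
        using less.prems(1) in_arcs_imp_in_arcs_ends
        by (fastforce simp: symmetric_arc_def awalk_Cons_iff awalk_Nil_iff)
      then have "num_asymmetric_arcs G p = 0"
        by (simp add: num_asymmetric_arcs_def filter_empty_conv)
      then show ?thesis using less.prems(2) by simp
    qed
  next
    case False
    have es: "awalk (head G e) es u" "\<not> distinct (awalk_verts (head G e) es)"
      using False less.prems p by (auto simp: awalk_Cons_iff)
    obtain q r s w where dec: "es = q @ r @ s" "awalk (head G e) q w" "awalk w r w" "awalk w s u"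
      "closed_w r"
      using awalk_cyc_decompE'[OF es] by metis
    then have "r \<noteq> []" by (auto simp: closed_w_def)
    have e: "e \<in> arcs G" "u = tail G e" using less.prems p by (auto simp: awalk_Cons_iff)
    have "awalk u (e # q @ s) u"
      using awalk_appendI[OF dec(2,4)] e by (simp add: awalk_Cons_iff del: awalk_append_iff)
    then have "n * num_asymmetric_arcs G (e # q @ s) < length (e # q @ s)"
      using less.hyps[of "e # q @ s" u] \<open>r \<noteq> []\<close> p dec(1) by simp
    moreover have "n * num_asymmetric_arcs G r < length r"
      using less.hyps[OF _ dec(3)] \<open>r \<noteq> []\<close> p dec(1) by simp
    moreover have "num_asymmetric_arcs G p
        = num_asymmetric_arcs G (e # q @ s) + num_asymmetric_arcs G r"
      by (simp add: p dec(1) num_asymmetric_arcs_def)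
    ultimately show ?thesis by (simp add: p dec(1) algebra_simps)
  qed
qed

theorem (in fin_digraph) k_kernel_if_cycles_have_few_asymmetric_arcs:
  assumes "\<And>B. cycle B \<Longrightarrow> length B \<ge> 3 \<Longrightarrow> n * num_asymmetric_arcs G B < length B"
  shows "\<exists>S. k_kernel G (Suc n) S"
proof -
  define R where "R u v \<longleftrightarrow> digraph_dist G u v \<le> ereal (real n)" for u v
  have "acyclic {(u, v). u \<in> verts G \<and> v \<in> verts G \<and> R u v \<and> \<not> R v u}"
  proof (rule acyclicI, intro allI notI)
    fix u
    assume "(u, u) \<in> {(u, v). u \<in> verts G \<and> v \<in> verts G \<and> R u v \<and> \<not> R v u}\<^sup>+"
    then obtain p where p: "awalk u p u" "p \<noteq> []" "length p \<le> n * num_asymmetric_arcs G p"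
      unfolding R_def using trancl_one_way_reach_imp_awalk by blast
    then show False
      using closed_awalk_asymmetric_arcs_less[OF assms p(1,2)] by simp
  qed
  then obtain S where "S \<subseteq> verts G" "\<forall>u\<in>S. \<forall>v\<in>S. u \<noteq> v \<longrightarrow> \<not> R u v"
    "\<forall>u\<in>verts G - S. \<exists>v\<in>S. R u v"
    using acyclic_asymmetric_part_imp_kernel[of "verts G" R] by auto
  then have "k_kernel G (Suc n) S"
    unfolding k_kernel_def k_independent_def l_absorbent_def R_def
    using digraph_dist_ge_Suc by simp
  then show ?thesis ..
qed

theorem corollary14:
  fixes D :: "('a, 'b) pre_digraph"
  assumes "digraph D"
    and "\<And>B. pre_digraph.cycle D B \<Longrightarrow> length B \<ge> 3 \<Longrightarrow>
           real (num_symmetric_arcs D B) \<ge> 2 / 3 * real (length B) + 1"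
  shows "\<exists>S. k_kernel D 4 S"
proof -
  interpret digraph D by fact
  have "3 * num_asymmetric_arcs D B < length B" if B: "cycle B" "length B \<ge> 3" for B
  proof -
    have "distinct B"
      using B(1) by (auto simp: cycle_def intro: distinct_tl_verts_imp_distinct)
    then have "num_symmetric_arcs D B = length (filter (symmetric_arc D) B)"
      by (simp add: num_symmetric_arcs_def distinct_length_filter Int_def conj_commute)
    then have "num_symmetric_arcs D B + num_asymmetric_arcs D B = length B"
      by (simp add: num_asymmetric_arcs_def sum_length_filter_compl)
    with assms(2)[OF B] show ?thesis by linarith
  qed
  then have "\<exists>S. k_kernel D (Suc 3) S"
    by (rule k_kernel_if_cycles_have_few_asymmetric_arcs)
  then show ?thesis by simp
qed

end
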